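(* Let $A=(A_1,A_2,A_3,A_4):I\to\mathbb{R}^{3\times 4}$ be smooth on an open interval $I$, with columns linearly independent over $\mathbb{R}$ (as functions on $I$). Suppose $p_{123}=1$, $p_{124}=p_{134}=0$ and $Q_{ij}=c_{ij}$ is constant for all $1\le i<j\le 4$. Then $c_{14}\neq 0$ and $A$ can be written as $$A=\hat R\begin{pmatrix}1&0&0\\0&\cos\theta&-\sin\theta\\0&\sin\theta&\cos\theta\end{pmatrix}\begin{pmatrix}b_{11}&b_{12}&b_{13}&b_{14}\\0&b_{22}&b_{23}&0\\0&0&1/(b_{11}b_{22})&0\end{pmatrix},$$ where $\hat R\in SO(3)$ is a constant rotation, $\theta,b_{11},b_{22}$ and the other $b_{ij}$ are smooth functions of $t$ ($b_{11},b_{22}$ nowhere zero), and $$b_{14}b_{11}'-b_{11}b_{14}'=c_{14},\qquad b_{12}=\frac{c_{24}b_{11}+c_{12}b_{14}}{c_{14}},\qquad b_{13}=\frac{c_{34}b_{11}+c_{13}b_{14}}{c_{14}},$$ $$b_{23}'=\frac{b_{11}b_{23}b_{22}'+2\theta'}{b_{11}b_{22}}-\Big(c_{23}+\frac{c_{12}c_{34}-c_{13}c_{24}}{c_{14}}\Big)\frac1{b_{22}} .$$ Conversely, the functions $\theta,b_{11},b_{22}$ (with $b_{11},b_{22}$ nowhere zero), the rotation $\hat R$ and the constants $c_{ij}$ (with $c_{14}\ne0$) may be chosen arbitrarily: every matrix $A$ of this form satisfies the stated conditions on $p_{ijk}$ and $Q_{ij}$.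
   Context: For $A(t)\in\mathbb{R}^{3\times m}$ with columns $A_i$, set $p_{ijk}=\det(A_i,A_j,A_k)$ and $Q_{ij}=\langle A_i',A_j\rangle-\langle A_j',A_i\rangle$, where $'=d/dt$. Origin: one looks for solutions $\varphi(z,t)=A(t)v(z)$ of the 3D incompressible Euler equations in Lagrangian form. With $v=(z_1,z_2,z_3,f(z_2,z_3))$, $f$ arbitrary, the stated conditions on $p_{ijk},Q_{ij}$ are the (normalized) conditions for the time component $A$. Solutions in which the columns of $A$ are linearly dependent over $\mathbb{R}$ are called reducible and discarded. *)

theory Defs
  imports "HOL-Analysis.Analysis"
begin

(* For open I this is C-infinity on I. vector_derivative is an arbitrary value where the
   derivative does not exist, hence differentiability is demanded at every order. *)
definition smooth_on :: "real set \<Rightarrow> (real \<Rightarrow> 'a::real_normed_vector) \<Rightarrow> bool" where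
  "smooth_on I f \<longleftrightarrow>
    (\<forall>n. \<forall>t\<in>I. ((\<lambda>g s. vector_derivative g (at s)) ^^ n) f differentiable (at t))"

(* The rows of vector [...] are the listed vectors, so the transpose has them as columns. *)
definition minor3 :: "(real \<Rightarrow> real^'m^3) \<Rightarrow> 'm \<Rightarrow> 'm \<Rightarrow> 'm \<Rightarrow> real \<Rightarrow> real" where
  "minor3 A i j k t =
    det (transpose (vector [column i (A t), column j (A t), column k (A t)]) :: real^3^3)"

definition Qform :: "(real \<Rightarrow> real^'m^3) \<Rightarrow> 'm \<Rightarrow> 'm \<Rightarrow> real \<Rightarrow> real" where
  "Qform A i j t =
    vector_derivative (\<lambda>s. column i (A s)) (at t) \<bullet> column j (A t)
    - vector_derivative (\<lambda>s. column j (A s)) (at t) \<bullet> column i (A t)"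

definition columns_lin_indep :: "real set \<Rightarrow> (real \<Rightarrow> real^'m^3) \<Rightarrow> bool" where
  "columns_lin_indep I A \<longleftrightarrow>
    (\<forall>x::'m \<Rightarrow> real. (\<forall>t\<in>I. (\<Sum>j\<in>UNIV. x j *\<^sub>R column j (A t)) = 0) \<longrightarrow> (\<forall>j. x j = 0))"

(* The pairs i < j are listed explicitly: in the index type 4 the numeral 4 equals 0, so the
   order of that type is not the intended one. Other values of c are irrelevant. *)
definition time_conditions :: "real set \<Rightarrow> (4 \<Rightarrow> 4 \<Rightarrow> real) \<Rightarrow> (real \<Rightarrow> real^4^3) \<Rightarrow> bool" where
  "time_conditions I c A \<longleftrightarrow>
    (\<forall>t\<in>I. minor3 A 1 2 3 t = 1 \<and> minor3 A 1 2 4 t = 0 \<and> minor3 A 1 3 4 t = 0 \<and>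
      (\<forall>(i, j) \<in> {(1,2), (1,3), (1,4), (2,3), (2,4), (3,4)}. Qform A i j t = c i j))"

definition rot_x :: "real \<Rightarrow> real^3^3" where
  "rot_x \<theta> = vector
    [vector [1, 0, 0],
     vector [0, cos \<theta>, - sin \<theta>],
     vector [0, sin \<theta>, cos \<theta>]]"

definition triangular_factor ::
    "real \<Rightarrow> real \<Rightarrow> real \<Rightarrow> real \<Rightarrow> real \<Rightarrow> real \<Rightarrow> real^4^3" where
  "triangular_factor b11 b12 b13 b14 b22 b23 = vector
    [vector [b11, b12, b13, b14],
     vector [0, b22, b23, 0],
     vector [0, 0, 1 / (b11 * b22), 0]]"

definition normal_form ::
    "real^3^3 \<Rightarrow> (real \<Rightarrow> real) \<Rightarrow> (real \<Rightarrow> real) \<Rightarrow> (real \<Rightarrow> real) \<Rightarrow> (real \<Rightarrow> real) \<Rightarrow> (real \<Rightarrow> real)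
      \<Rightarrow> (real \<Rightarrow> real) \<Rightarrow> (real \<Rightarrow> real) \<Rightarrow> real \<Rightarrow> real^4^3" where
  "normal_form R \<theta> b11 b12 b13 b14 b22 b23 t =
    R ** rot_x (\<theta> t) ** triangular_factor (b11 t) (b12 t) (b13 t) (b14 t) (b22 t) (b23 t)"

definition free_data :: "real set \<Rightarrow> (real \<Rightarrow> real) \<Rightarrow> (real \<Rightarrow> real) \<Rightarrow> (real \<Rightarrow> real) \<Rightarrow> bool" where
  "free_data I \<theta> b11 b22 \<longleftrightarrow>
    smooth_on I \<theta> \<and> smooth_on I b11 \<and> smooth_on I b22 \<and> (\<forall>t\<in>I. b11 t \<noteq> 0 \<and> b22 t \<noteq> 0)"

definition dependent_data ::
    "real set \<Rightarrow> (4 \<Rightarrow> 4 \<Rightarrow> real) \<Rightarrow> (real \<Rightarrow> real) \<Rightarrow> (real \<Rightarrow> real) \<Rightarrow> (real \<Rightarrow> real)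
      \<Rightarrow> (real \<Rightarrow> real) \<Rightarrow> (real \<Rightarrow> real) \<Rightarrow> (real \<Rightarrow> real) \<Rightarrow> (real \<Rightarrow> real) \<Rightarrow> bool" where
  "dependent_data I c \<theta> b11 b12 b13 b14 b22 b23 \<longleftrightarrow>
    smooth_on I b12 \<and> smooth_on I b13 \<and> smooth_on I b14 \<and> smooth_on I b23 \<and>
    (\<forall>t\<in>I.
      b14 t * deriv b11 t - b11 t * deriv b14 t = c 1 4 \<and>
      b12 t = (c 2 4 * b11 t + c 1 2 * b14 t) / c 1 4 \<and>
      b13 t = (c 3 4 * b11 t + c 1 3 * b14 t) / c 1 4 \<and>
      deriv b23 t =
        (b11 t * b23 t * deriv b22 t + 2 * deriv \<theta> t) / (b11 t * b22 t)
        - (c 2 3 + (c 1 2 * c 3 4 - c 1 3 * c 2 4) / c 1 4) * (1 / b22 t))"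

end

theory Submission
  imports Defs
begin

text \<open>
  Since \<open>p\<^sub>1\<^sub>2\<^sub>3 = 1\<close>, the first three columns form a basis of space at every time, and
  \<open>p\<^sub>1\<^sub>2\<^sub>4 = p\<^sub>1\<^sub>3\<^sub>4 = 0\<close> then force the fourth column to be a multiple \<open>l A\<^sub>1\<close> of the first, by
  Cramer's rule. The conditions on \<open>Q\<^sub>1\<^sub>x\<close> and \<open>Q\<^sub>x\<^sub>4\<close> for \<open>x = 1, 2, 3\<close> combine to
  \<open>l' \<langle>A\<^sub>1, A\<^sub>x\<rangle> = - c\<^sub>x\<^sub>4 - l c\<^sub>1\<^sub>x\<close>. The case \<open>x = 1\<close> is \<open>l' |A\<^sub>1|\<^sup>2 = - c\<^sub>1\<^sub>4\<close>; hence \<open>c\<^sub>1\<^sub>4 = 0\<close> would make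
  \<open>l\<close> constant and the columns linearly dependent. Differentiating these three identities shows
  that \<open>2 l' A\<^sub>1' + l'' A\<^sub>1\<close> is orthogonal to all of \<open>A\<^sub>1, A\<^sub>2, A\<^sub>3\<close>, so it vanishes: \<open>A\<^sub>1'\<close> is
  parallel to \<open>A\<^sub>1\<close>, and the direction of \<open>A\<^sub>1\<close> is constant
  (\<open>first_column_constant_direction\<close>).

  A constant rotation moves this direction to the first axis. What remains of the second column,
  a nowhere vanishing smooth curve in the plane orthogonal to that axis, is written in smooth polar
  coordinates (\<open>smooth_polar_coordinates\<close>), and the third column is expressed in the rotating frame;
  the condition \<open>p\<^sub>1\<^sub>2\<^sub>3 = 1\<close> fixes its last coefficient. This is the normal form.

  For a matrix in normal form the conditions on the minors hold automatically, and the conditions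
  on \<open>Q\<close> say that certain Wronskians of the first-row entries are the given constants, with an extra
  term in \<open>Q\<^sub>2\<^sub>3\<close> for the rotation (\<open>time_conditions_normal_form_iff\<close>). These equations are
  equivalent to the formulas that determine \<open>b\<^sub>1\<^sub>2, b\<^sub>1\<^sub>3, b\<^sub>1\<^sub>4, b\<^sub>2\<^sub>3\<close>
  (\<open>wronskian_equations_iff_dependent_data\<close>). The equivalence settles both directions of the
  theorem; the freedom of choice then only needs that the linear differential equations for \<open>b\<^sub>1\<^sub>4\<close> and
  \<open>b\<^sub>2\<^sub>3\<close> can be solved by antiderivatives (\<open>dependent_data_exists\<close>).
\<close>

section \<open>Smooth functions of a real variable\<close>

text \<open>
  Smoothness is a condition on all iterated derivatives. Closure of smooth functions under products,
  quotients and the like is proved order by order, and the recursion below, which may use any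
  function that equals the derivative on the set, is the form that induction on the order wants.
\<close>

primrec differentiable_times ::
    "nat \<Rightarrow> real set \<Rightarrow> (real \<Rightarrow> 'a::real_normed_vector) \<Rightarrow> bool" where
  "differentiable_times 0 I f = True"
| "differentiable_times (Suc n) I f =
    (\<exists>g. (\<forall>t\<in>I. (f has_vector_derivative g t) (at t)) \<and> differentiable_times n I g)"

lemma differentiable_times_SucI:
  assumes "\<And>t. t \<in> I \<Longrightarrow> (f has_vector_derivative g t) (at t)" "differentiable_times n I g"
  shows "differentiable_times (Suc n) I f"
  using assms by auto

lemma has_vector_derivative_cong_open:
  assumes "open I" "t \<in> I" "\<And>s. s \<in> I \<Longrightarrow> f s = g s" "(f has_vector_derivative d) (at t)"
  shows "(g has_vector_derivative d) (at t)"
  by (rule has_vector_derivative_transform_within_open[OF assms(4,1,2)]) (simp add: assms(3))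

lemma differentiable_times_cong:
  assumes "open I" "\<And>t. t \<in> I \<Longrightarrow> f t = g t" "differentiable_times n I f"
  shows "differentiable_times n I g"
proof (cases n)
  case (Suc m)
  then obtain h where "\<And>t. t \<in> I \<Longrightarrow> (f has_vector_derivative h t) (at t)"
      "differentiable_times m I h"
    using assms(3) by auto
  then show ?thesis
    unfolding Suc differentiable_times.simps
    by (intro exI[of _ h] conjI ballI has_vector_derivative_cong_open[OF assms(1) _ assms(2)])
qed simp

text \<open>
  Openness enters because the iterates of the derivative operator agree with a given derivative on
  the set only, and differentiability at a point needs agreement in a neighbourhood.
\<close>

lemma differentiable_times_iff_iterates:
  assumes "open I"
  shows "differentiable_times n I f \<longleftrightarrow>
    (\<forall>k<n. \<forall>t\<in>I. ((\<lambda>g s. vector_derivative g (at s)) ^^ k) f differentiable (at t))"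
proof (induction n arbitrary: f)
  case (Suc n)
  let ?D = "\<lambda>(g::real \<Rightarrow> 'a) s. vector_derivative g (at s)"
  have "differentiable_times (Suc n) I f \<longleftrightarrow>
      (\<forall>t\<in>I. f differentiable (at t)) \<and> differentiable_times n I (?D f)"
  proof
    assume "differentiable_times (Suc n) I f"
    then obtain g where g: "\<And>t. t \<in> I \<Longrightarrow> (f has_vector_derivative g t) (at t)"
        "differentiable_times n I g" by auto
    then have "differentiable_times n I (?D f)"
      using differentiable_times_cong[OF assms _ g(2)] vector_derivative_at[OF g(1)] by metis
    then show "(\<forall>t\<in>I. f differentiable (at t)) \<and> differentiable_times n I (?D f)"
      using g(1) differentiableI_vector by blast
  next
    assume "(\<forall>t\<in>I. f differentiable (at t)) \<and> differentiable_times n I (?D f)"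
    then show "differentiable_times (Suc n) I f"
      by (auto simp: vector_derivative_works)
  qed
  also have "\<dots> \<longleftrightarrow> (\<forall>k<Suc n. \<forall>t\<in>I. (?D ^^ k) f differentiable (at t))"
    unfolding Suc.IH All_less_Suc2 funpow_Suc_right o_def by simp
  finally show ?case .
qed simp

lemma smooth_on_iff_differentiable_times:
  assumes "open I"
  shows "smooth_on I f \<longleftrightarrow> (\<forall>n. differentiable_times n I f)"
  unfolding smooth_on_def differentiable_times_iff_iterates[OF assms] by (meson lessI)

lemma differentiable_times_SucD: "differentiable_times (Suc n) I f \<Longrightarrow> differentiable_times n I f"
  by (induction n arbitrary: f) auto

lemma smooth_on_cong:
  assumes "open I" "\<And>t. t \<in> I \<Longrightarrow> f t = g t" "smooth_on I f"
  shows "smooth_on I g"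
  using assms differentiable_times_cong[OF assms(1,2)]
  by (auto simp: smooth_on_iff_differentiable_times)

lemma smooth_on_has_vector_derivative:
  assumes "smooth_on I f" "t \<in> I"
  shows "(f has_vector_derivative vector_derivative f (at t)) (at t)"
proof -
  have "((\<lambda>g s. vector_derivative g (at s)) ^^ 0) f differentiable (at t)"
    using assms unfolding smooth_on_def by blast
  then show ?thesis by (simp add: vector_derivative_works)
qed

lemma smooth_on_has_real_derivative:
  assumes "smooth_on I f" "t \<in> I"
  shows "(f has_real_derivative deriv f t) (at t)"
  using smooth_on_has_vector_derivative[OF assms]
  by (metis DERIV_deriv_iff_has_field_derivative has_real_derivative_iff_has_vector_derivative)

lemma smooth_on_deriv:
  assumes "open I" "smooth_on I f"
  shows "smooth_on I (deriv f)"
proof -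
  have "smooth_on I (\<lambda>t. vector_derivative f (at t))"
    unfolding smooth_on_def
  proof
    fix n
    have "((\<lambda>g s. vector_derivative g (at s)) ^^ Suc n) f
        = ((\<lambda>g s. vector_derivative g (at s)) ^^ n) (\<lambda>t. vector_derivative f (at t))"
      by (simp only: funpow_Suc_right o_def)
    then show "\<forall>t\<in>I. ((\<lambda>g s. vector_derivative g (at s)) ^^ n) (\<lambda>t. vector_derivative f (at t))
        differentiable (at t)"
      using assms(2) unfolding smooth_on_def by metis
  qed
  then show ?thesis
  proof (rule smooth_on_cong[OF assms(1), rotated])
    fix t assume "t \<in> I"
    then show "vector_derivative f (at t) = deriv f t"
      using smooth_on_has_real_derivative[OF assms(2)] vector_derivative_at
      by (metis has_real_derivative_iff_has_vector_derivative)
  qed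
qed

lemma smooth_on_if_derivative:
  assumes "open I" "\<And>t. t \<in> I \<Longrightarrow> (f has_vector_derivative g t) (at t)" "smooth_on I g"
  shows "smooth_on I f"
  unfolding smooth_on_iff_differentiable_times[OF assms(1)]
proof
  fix n
  show "differentiable_times n I f"
  proof (cases n)
    case (Suc m)
    then show ?thesis
      using assms unfolding smooth_on_iff_differentiable_times[OF assms(1)] by auto
  qed simp
qed

lemma smooth_on_const: "open I \<Longrightarrow> smooth_on I (\<lambda>t. c)"
proof -
  have "differentiable_times n I (\<lambda>t. c)" for n and c :: 'a
    by (induction n arbitrary: c) (auto intro!: exI[of _ "\<lambda>t. 0"])
  then show "open I \<Longrightarrow> smooth_on I (\<lambda>t. c)" by (simp add: smooth_on_iff_differentiable_times)
qed

lemma differentiable_times_add: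
  assumes "differentiable_times n I f" "differentiable_times n I g"
  shows "differentiable_times n I (\<lambda>t. f t + g t)"
  using assms
proof (induction n arbitrary: f g)
  case (Suc n)
  obtain f' where f':
    "\<And>t. t \<in> I \<Longrightarrow> (f has_vector_derivative f' t) (at t)" "differentiable_times n I f'"
    using Suc.prems(1) by auto
  obtain g' where g':
    "\<And>t. t \<in> I \<Longrightarrow> (g has_vector_derivative g' t) (at t)" "differentiable_times n I g'"
    using Suc.prems(2) by auto
  have "differentiable_times n I (\<lambda>t. f' t + g' t)"
    using Suc.IH[OF f'(2) g'(2)] .
  then show ?case
    by (rule differentiable_times_SucI[rotated]) (intro has_vector_derivative_add f' g')
qed simp

lemma differentiable_times_bounded_linear:
  assumes "bounded_linear h" "differentiable_times n I f"
  shows "differentiable_times n I (\<lambda>t. h (f t))"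
  using assms(2)
proof (induction n arbitrary: f)
  case (Suc n)
  obtain f' where f':
    "\<And>t. t \<in> I \<Longrightarrow> (f has_vector_derivative f' t) (at t)" "differentiable_times n I f'"
    using Suc.prems by auto
  have "differentiable_times n I (\<lambda>t. h (f' t))"
    using Suc.IH[OF f'(2)] .
  then show ?case
    by (rule differentiable_times_SucI[rotated])
      (intro bounded_linear.has_vector_derivative[OF assms(1)] f')
qed simp

lemma differentiable_times_bounded_bilinear:
  assumes "bounded_bilinear p" "differentiable_times n I f" "differentiable_times n I g"
  shows "differentiable_times n I (\<lambda>t. p (f t) (g t))"
  using assms(2,3)
proof (induction n arbitrary: f g)
  case (Suc n)
  obtain f' where f':
    "\<And>t. t \<in> I \<Longrightarrow> (f has_vector_derivative f' t) (at t)" "differentiable_times n I f'"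
    using Suc.prems(1) by auto
  obtain g' where g':
    "\<And>t. t \<in> I \<Longrightarrow> (g has_vector_derivative g' t) (at t)" "differentiable_times n I g'"
    using Suc.prems(2) by auto
  have "differentiable_times n I (\<lambda>t. p (f t) (g' t) + p (f' t) (g t))"
    by (intro differentiable_times_add Suc.IH f' g' Suc.prems[THEN differentiable_times_SucD])
  then show ?case
    by (rule differentiable_times_SucI[rotated])
      (intro bounded_bilinear.has_vector_derivative[OF assms(1)] f' g')
qed simp

lemmas differentiable_times_mult = differentiable_times_bounded_bilinear[OF bounded_bilinear_mult]

lemma differentiable_times_inverse:
  fixes f :: "real \<Rightarrow> real"
  assumes "differentiable_times n I f" "\<And>t. t \<in> I \<Longrightarrow> f t \<noteq> 0"
  shows "differentiable_times n I (\<lambda>t. inverse (f t))"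
  using assms
proof (induction n)
  case (Suc n)
  obtain f' where *:
    "\<And>t. t \<in> I \<Longrightarrow> (f has_vector_derivative f' t) (at t)" "differentiable_times n I f'"
    using Suc.prems(1) by auto
  have i: "differentiable_times n I (\<lambda>t. inverse (f t))"
    using Suc differentiable_times_SucD by blast
  have "differentiable_times n I (\<lambda>t. - (inverse (f t) * f' t * inverse (f t)))"
    by (intro differentiable_times_bounded_linear[OF bounded_linear_minus[OF bounded_linear_ident]]
        differentiable_times_mult i *)
  moreover have "((\<lambda>t. inverse (f t)) has_vector_derivative
      - (inverse (f t) * f' t * inverse (f t))) (at t)" if "t \<in> I" for t
    using *(1)[OF that] Suc.prems(2)[OF that]
    unfolding has_real_derivative_iff_has_vector_derivative[symmetric] by (rule DERIV_inverse')
  ultimately show ?case by (rule differentiable_times_SucI[rotated])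
qed simp

lemma differentiable_times_cos_sin:
  assumes "differentiable_times n I f"
  shows "differentiable_times n I (\<lambda>t. cos (f t :: real)) \<and> differentiable_times n I (\<lambda>t. sin (f t))"
  using assms
proof (induction n)
  case (Suc n)
  obtain f' where *:
    "\<And>t. t \<in> I \<Longrightarrow> (f has_vector_derivative f' t) (at t)" "differentiable_times n I f'"
    using Suc.prems(1) by auto
  have i: "differentiable_times n I (\<lambda>t. cos (f t))" "differentiable_times n I (\<lambda>t. sin (f t))"
    using Suc differentiable_times_SucD by blast+
  have c: "differentiable_times n I (\<lambda>t. - (sin (f t) * f' t))"
    by (intro differentiable_times_bounded_linear[OF bounded_linear_minus[OF bounded_linear_ident]]
        differentiable_times_mult i *)
  have s: "differentiable_times n I (\<lambda>t. cos (f t) * f' t)"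
    by (intro differentiable_times_mult i *)
  have "((\<lambda>t. cos (f t)) has_vector_derivative - (sin (f t) * f' t)) (at t)"
       "((\<lambda>t. sin (f t)) has_vector_derivative cos (f t) * f' t) (at t)" if "t \<in> I" for t
    using *(1)[OF that] unfolding has_real_derivative_iff_has_vector_derivative[symmetric]
    by (auto intro!: derivative_eq_intros)
  then show ?case
    using differentiable_times_SucI[OF _ c] differentiable_times_SucI[OF _ s] by simp
qed simp

context
  fixes I :: "real set"
  assumes open_I: "open I"
begin

lemmas smooth_on_times = smooth_on_iff_differentiable_times[OF open_I]

lemma smooth_on_bounded_linear: "bounded_linear h \<Longrightarrow> smooth_on I f \<Longrightarrow> smooth_on I (\<lambda>t. h (f t))"
  by (simp add: smooth_on_times differentiable_times_bounded_linear)

lemma smooth_on_add: "smooth_on I f \<Longrightarrow> smooth_on I g \<Longrightarrow> smooth_on I (\<lambda>t. f t + g t)"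
  by (simp add: smooth_on_times differentiable_times_add)

lemma smooth_on_minus: "smooth_on I f \<Longrightarrow> smooth_on I (\<lambda>t. - f t)"
  by (rule smooth_on_bounded_linear[OF bounded_linear_minus[OF bounded_linear_ident]])

lemma smooth_on_diff: "smooth_on I f \<Longrightarrow> smooth_on I g \<Longrightarrow> smooth_on I (\<lambda>t. f t - g t)"
  using smooth_on_add[OF _ smooth_on_minus, of f g] by simp

lemma smooth_on_mult:
  fixes f g :: "real \<Rightarrow> real"
  shows "smooth_on I f \<Longrightarrow> smooth_on I g \<Longrightarrow> smooth_on I (\<lambda>t. f t * g t)"
  by (simp add: smooth_on_times differentiable_times_mult)

lemma smooth_on_inner: "smooth_on I f \<Longrightarrow> smooth_on I g \<Longrightarrow> smooth_on I (\<lambda>t. f t \<bullet> g t)"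
  by (simp add: smooth_on_times differentiable_times_bounded_bilinear[OF bounded_bilinear_inner])

lemma smooth_on_divide:
  fixes f g :: "real \<Rightarrow> real"
  shows "smooth_on I f \<Longrightarrow> smooth_on I g \<Longrightarrow> (\<And>t. t \<in> I \<Longrightarrow> g t \<noteq> 0) \<Longrightarrow> smooth_on I (\<lambda>t. f t / g t)"
  by (simp add: smooth_on_times divide_inverse differentiable_times_mult differentiable_times_inverse)

lemma smooth_on_cos: "smooth_on I f \<Longrightarrow> smooth_on I (\<lambda>t. cos (f t :: real))"
  and smooth_on_sin: "smooth_on I f \<Longrightarrow> smooth_on I (\<lambda>t. sin (f t :: real))"
  by (simp_all add: smooth_on_times differentiable_times_cos_sin)

lemmas smooth_on_arith =
  smooth_on_add smooth_on_diff smooth_on_mult smooth_on_minus smooth_on_const[OF open_I]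
  smooth_on_divide smooth_on_cos smooth_on_sin

lemma smooth_on_entry:
  fixes A :: "real \<Rightarrow> real^'n^'m"
  assumes "smooth_on I A"
  shows "smooth_on I (\<lambda>t. A t $ i $ j)"
  by (rule smooth_on_bounded_linear[OF bounded_linear_vec_nth
        smooth_on_bounded_linear[OF bounded_linear_vec_nth assms]])

text \<open>
  The integral from a base point works. To differentiate it at a point, the fundamental theorem is
  applied on a compact subinterval that contains the base point and has the given point in its
  interior.
\<close>

lemma smooth_antiderivative:
  fixes f :: "real \<Rightarrow> real"
  assumes "is_interval I" "smooth_on I f"
  obtains F where "smooth_on I F" "\<And>t. t \<in> I \<Longrightarrow> (F has_real_derivative f t) (at t)"
proof (cases "I = {}")
  case True
  then have "(f has_real_derivative f t) (at t)" if "t \<in> I" for t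
    using that by blast
  with assms(2) show ?thesis by (rule that)
next
  case False
  then obtain t0 where t0: "t0 \<in> I" by blast
  define F where "F = (\<lambda>u::real. LBINT y=t0..u. f y)"
  have D: "(F has_real_derivative f t) (at t)" if "t \<in> I" for t
  proof -
    have "\<exists>e>0. cball t e \<subseteq> I"
      using that by (rule open_contains_cball_eq[OF open_I, rule_format, THEN iffD1])
    then obtain e where e: "e > 0" "cball t e \<subseteq> I" by (elim exE conjE)
    have "t - e \<in> cball t e" "t + e \<in> cball t e" using e(1) by (simp_all add: dist_real_def)
    then have te: "t - e \<in> I" "t + e \<in> I" using e(2) by blast+
    define a b where "a = min t0 (t - e)" and "b = max t0 (t + e)"
    have ab: "a \<in> I" "b \<in> I" using te t0 by (simp_all add: a_def b_def min_def max_def)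
    have "{a..b} \<subseteq> I"
      by (intro subsetI) (auto intro: mem_is_interval_1_I[OF assms(1) ab])
    moreover have "continuous_on I f"
      by (intro continuous_at_imp_continuous_on ballI)
        (rule DERIV_isCont[OF smooth_on_has_real_derivative[OF assms(2)]])
    ultimately have "continuous_on {a..b} f" using continuous_on_subset by blast
    moreover have "a \<le> t0" "t0 \<le> b" "a < t" "t < b" using e(1) by (auto simp: a_def b_def)
    ultimately have "(F has_vector_derivative f t) (at t within {a..b})"
      unfolding F_def by (intro interval_integral_FTC2) auto
    then have "(F has_vector_derivative f t) (at t within {a<..<b})"
      by (rule has_vector_derivative_within_subset) (simp add: greaterThanLessThan_subseteq_atLeastAtMost_iff)
    then have "(F has_vector_derivative f t) (at t)"
      using has_vector_derivative_within_open[of t "{a<..<b}" F "f t"] \<open>a < t\<close> \<open>t < b\<close> by simp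
    then show ?thesis unfolding has_real_derivative_iff_has_vector_derivative .
  qed
  have "smooth_on I F"
    by (rule smooth_on_if_derivative[OF open_I _ assms(2)])
      (rule D[unfolded has_real_derivative_iff_has_vector_derivative])
  then show ?thesis using D by (rule that)
qed

end

section \<open>Three-dimensional linear algebra\<close>

lemma vector_4:
  "(vector [x,y,z,w] :: ('a::zero)^4)$1 = x"
  "(vector [x,y,z,w] :: ('a::zero)^4)$2 = y"
  "(vector [x,y,z,w] :: ('a::zero)^4)$3 = z"
  "(vector [x,y,z,w] :: ('a::zero)^4)$4 = w"
  unfolding vector_def by simp_all

lemma column_matrix_mult:
  fixes R :: "real^'n^'l" and B :: "real^'m^'n"
  shows "column i (R ** B) = R *v column i B"
  by (simp add: column_def matrix_matrix_mult_def matrix_vector_mult_def vec_eq_iff)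

lemma inner_orthogonal_matrix:
  fixes R :: "real^'n^'n"
  assumes "orthogonal_matrix R"
  shows "(R *v v) \<bullet> (R *v w) = v \<bullet> w"
proof -
  have "orthogonal_transformation ((*v) R)"
    using assms by (simp add: orthogonal_transformation_matrix)
  then show ?thesis by (simp add: orthogonal_transformation_def)
qed

text \<open>
  Cramer's rule, multiplied by the determinant so that it holds for all vectors.
\<close>

lemma cramer_3:
  fixes x y z w :: "real^3"
  shows "det (vector [x,y,z]) *\<^sub>R w
    = det (vector [w,y,z]) *\<^sub>R x + det (vector [x,w,z]) *\<^sub>R y + det (vector [x,y,w]) *\<^sub>R z"
  by (simp add: vec_eq_iff forall_3 det_3) (simp add: algebra_simps)

lemma orthogonal_to_basis_3:
  fixes x y z w :: "real^3"
  assumes "det (vector [x,y,z]) \<noteq> 0" "w \<bullet> x = 0" "w \<bullet> y = 0" "w \<bullet> z = 0"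
  shows "w = 0"
proof -
  have "w \<bullet> (det (vector [x,y,z]) *\<^sub>R w) = 0"
    unfolding cramer_3[of x y z w] by (simp add: inner_add_right assms(2-4))
  then show ?thesis using assms(1) by simp
qed

lemma minor3_eq_det: "minor3 A i j k t = det (vector [column i (A t), column j (A t), column k (A t)] :: real^3^3)"
  by (simp add: minor3_def)

lemma minor3_rotation:
  assumes "rotation_matrix R"
  shows "minor3 (\<lambda>s. R ** B s) i j k t = minor3 B i j k t"
proof -
  have "transpose (vector [R *v x, R *v y, R *v z] :: real^3^3) = R ** transpose (vector [x, y, z])"
    for x y z :: "real^3"
    unfolding vec_eq_iff forall_3
    by (simp add: transpose_def matrix_matrix_mult_def matrix_vector_mult_def sum_3)
  then show ?thesis
    using assms by (simp add: minor3_def column_matrix_mult det_mul rotation_matrix_def)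
qed

lemma has_vector_derivative_vec:
  fixes f :: "'n::finite \<Rightarrow> real \<Rightarrow> real"
  assumes "\<And>k. (f k has_real_derivative d k) (at t)"
  shows "((\<lambda>s. \<chi> k. f k s) has_vector_derivative (\<chi> k. d k)) (at t)"
  unfolding has_vector_derivative_def
proof (subst has_derivative_componentwise_within, intro ballI)
  fix b :: "real^'n" assume "b \<in> Basis"
  then obtain k where b: "b = axis k 1" by (auto simp: Basis_vec_def)
  show "((\<lambda>s. (\<chi> k. f k s) \<bullet> b) has_derivative (\<lambda>h. (h *\<^sub>R (\<chi> k. d k)) \<bullet> b)) (at t)"
    using assms[of k] unfolding b has_field_derivative_def by (simp add: inner_axis mult_commute_abs)
qed

lemma has_vector_derivative_column:
  fixes B :: "real \<Rightarrow> real^'m^'n"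
  assumes "\<And>k. ((\<lambda>s. B s $ k $ j) has_real_derivative D k j) (at t)"
  shows "((\<lambda>s. column j (B s)) has_vector_derivative (\<chi> k. D k j)) (at t)"
  unfolding column_def by (rule has_vector_derivative_vec) (rule assms)

lemma Qform_entries:
  fixes B :: "real \<Rightarrow> real^'m^3"
  assumes "\<And>k j. ((\<lambda>s. B s $ k $ j) has_real_derivative D k j) (at t)"
  shows "Qform B i j t = (\<Sum>k\<in>UNIV. D k i * B t $ k $ j - D k j * B t $ k $ i)"
  unfolding Qform_def vector_derivative_at[OF has_vector_derivative_column[where D=D, OF assms]]
  by (simp add: inner_vec_def column_def sum_subtractf)

lemma Qform_rotation:
  fixes B :: "real \<Rightarrow> real^'m^3"
  assumes "orthogonal_matrix R" "\<And>j. (\<lambda>s. column j (B s)) differentiable (at t)"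
  shows "Qform (\<lambda>s. R ** B s) i j t = Qform B i j t"
proof -
  have "vector_derivative (\<lambda>s. column j (R ** B s)) (at t)
      = R *v vector_derivative (\<lambda>s. column j (B s)) (at t)" for j
    unfolding column_matrix_mult
    by (rule vector_derivative_at[OF bounded_linear.has_vector_derivative[OF matrix_vector_mul_bounded_linear]])
      (use assms(2) in \<open>simp add: vector_derivative_works\<close>)
  then show ?thesis by (simp add: Qform_def inner_orthogonal_matrix[OF assms(1)] column_matrix_mult)
qed

lemma Qform_cong:
  assumes "open I" "t \<in> I" "\<And>s. s \<in> I \<Longrightarrow> A s = B s"
  shows "Qform A i j t = Qform B i j t"
proof -
  have "vector_derivative (\<lambda>s. column j (A s)) (at t) = vector_derivative (\<lambda>s. column j (B s)) (at t)" for j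
    by (rule vector_derivative_cong_eq)
      (use eventually_nhds_in_open[OF assms(1,2)] assms(3) in \<open>auto elim!: eventually_mono\<close>)
  then show ?thesis using assms(2,3) by (simp add: Qform_def)
qed

lemma time_conditions_cong:
  assumes "open I" "\<And>s. s \<in> I \<Longrightarrow> A s = B s"
  shows "time_conditions I c A \<longleftrightarrow> time_conditions I c B"
  using assms(2) unfolding time_conditions_def minor3_def
  by (simp add: Qform_cong[OF assms(1) _ assms(2)] cong: ball_cong)

section \<open>The conditions in terms of the normal form\<close>

text \<open>
  The six conditions on \<open>Q\<close> for a matrix in normal form. All but the last involve only the first row:
  they pair a column with column 1 or 4, which vanishes below the first row, and the rotation acts
  on the other two rows alone.
\<close>

definition wronskian_equations ::
    "real set \<Rightarrow> (4 \<Rightarrow> 4 \<Rightarrow> real) \<Rightarrow> (real \<Rightarrow> real) \<Rightarrow> (real \<Rightarrow> real) \<Rightarrow> (real \<Rightarrow> real)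
      \<Rightarrow> (real \<Rightarrow> real) \<Rightarrow> (real \<Rightarrow> real) \<Rightarrow> (real \<Rightarrow> real) \<Rightarrow> (real \<Rightarrow> real) \<Rightarrow> bool" where
  "wronskian_equations I c \<theta> b11 b12 b13 b14 b22 b23 \<longleftrightarrow> (\<forall>t\<in>I.
      deriv b11 t * b12 t - deriv b12 t * b11 t = c 1 2 \<and>
      deriv b11 t * b13 t - deriv b13 t * b11 t = c 1 3 \<and>
      deriv b11 t * b14 t - deriv b14 t * b11 t = c 1 4 \<and>
      deriv b12 t * b14 t - deriv b14 t * b12 t = c 2 4 \<and>
      deriv b13 t * b14 t - deriv b14 t * b13 t = c 3 4 \<and>
      deriv b12 t * b13 t - deriv b13 t * b12 t
        + (deriv b22 t * b23 t - deriv b23 t * b22 t) + 2 * deriv \<theta> t / b11 t = c 2 3)"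

text \<open>
  Constant rotations change neither the minors nor \<open>Q\<close>, so only the rotation by \<open>\<theta>\<close> and the
  triangular factor matter. In \<open>Q\<^sub>2\<^sub>3\<close> the derivative of \<open>\<theta>\<close> contributes
  \<open>2 \<theta>' b\<^sub>2\<^sub>2 b\<^sub>3\<^sub>3\<close>, where \<open>b\<^sub>3\<^sub>3 = 1 / (b\<^sub>1\<^sub>1 b\<^sub>2\<^sub>2)\<close>.
\<close>

lemma time_conditions_normal_form_iff:
  fixes \<theta> b11 b12 b13 b14 b22 b23 :: "real \<Rightarrow> real"
  assumes "open I" "rotation_matrix R"
    and smooth: "smooth_on I \<theta>" "smooth_on I b11" "smooth_on I b12" "smooth_on I b13"
      "smooth_on I b14" "smooth_on I b22" "smooth_on I b23"
    and nz: "\<And>t. t \<in> I \<Longrightarrow> b11 t \<noteq> 0" "\<And>t. t \<in> I \<Longrightarrow> b22 t \<noteq> 0"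
  shows "time_conditions I c (normal_form R \<theta> b11 b12 b13 b14 b22 b23) \<longleftrightarrow>
    wronskian_equations I c \<theta> b11 b12 b13 b14 b22 b23"
proof -
  define M where "M s = rot_x (\<theta> s) ** triangular_factor (b11 s) (b12 s) (b13 s) (b14 s) (b22 s) (b23 s)" for s
  define b33 where "b33 s = 1 / (b11 s * b22 s)" for s
  have nf: "normal_form R \<theta> b11 b12 b13 b14 b22 b23 = (\<lambda>t. R ** M t)"
    by (simp add: fun_eq_iff normal_form_def M_def matrix_mul_assoc)
  have M: "M s $ 1 $ 1 = b11 s" "M s $ 1 $ 2 = b12 s" "M s $ 1 $ 3 = b13 s" "M s $ 1 $ 4 = b14 s"
      "M s $ 2 $ 1 = 0" "M s $ 2 $ 2 = cos (\<theta> s) * b22 s"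
      "M s $ 2 $ 3 = cos (\<theta> s) * b23 s - sin (\<theta> s) * b33 s" "M s $ 2 $ 4 = 0"
      "M s $ 3 $ 1 = 0" "M s $ 3 $ 2 = sin (\<theta> s) * b22 s"
      "M s $ 3 $ 3 = sin (\<theta> s) * b23 s + cos (\<theta> s) * b33 s" "M s $ 3 $ 4 = 0" for s
    by (simp_all add: M_def b33_def rot_x_def triangular_factor_def matrix_matrix_mult_def sum_3 vector_4)
  have "smooth_on I b33"
    unfolding b33_def using nz by (intro smooth_on_arith smooth assms(1)) auto
  note smooth = smooth this
  define D :: "real \<Rightarrow> real^4^3" where "D t = vector [
      vector [deriv b11 t, deriv b12 t, deriv b13 t, deriv b14 t],
      vector [0, cos (\<theta> t) * deriv b22 t - sin (\<theta> t) * deriv \<theta> t * b22 t,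
        cos (\<theta> t) * deriv b23 t - sin (\<theta> t) * deriv \<theta> t * b23 t
          - (sin (\<theta> t) * deriv b33 t + cos (\<theta> t) * deriv \<theta> t * b33 t), 0],
      vector [0, sin (\<theta> t) * deriv b22 t + cos (\<theta> t) * deriv \<theta> t * b22 t,
        sin (\<theta> t) * deriv b23 t + cos (\<theta> t) * deriv \<theta> t * b23 t
          + (cos (\<theta> t) * deriv b33 t - sin (\<theta> t) * deriv \<theta> t * b33 t), 0]]" for t
  have D: "((\<lambda>s. M s $ k $ j) has_real_derivative D t $ k $ j) (at t)" if "t \<in> I" for t k j
  proof -
    note d = smooth[THEN smooth_on_has_real_derivative, OF that]
    have "\<forall>k j. ((\<lambda>s. M s $ k $ j) has_real_derivative D t $ k $ j) (at t)"
      unfolding forall_3 forall_4 M D_def vector_3 vector_4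
      by (intro conjI d DERIV_const; auto intro!: derivative_eq_intros d simp: algebra_simps)
    then show ?thesis by blast
  qed
  have Q: "Qform (normal_form R \<theta> b11 b12 b13 b14 b22 b23) i j t
      = (\<Sum>k\<in>UNIV. D t $ k $ i * M t $ k $ j - D t $ k $ j * M t $ k $ i)" if "t \<in> I" for t i j
  proof -
    have "(\<lambda>s. column j (M s)) differentiable (at t)" for j
      using has_vector_derivative_column[where D="\<lambda>k j. D t $ k $ j", OF D[OF that]]
      by (rule differentiableI_vector)
    then have "Qform (normal_form R \<theta> b11 b12 b13 b14 b22 b23) i j t = Qform M i j t"
      unfolding nf using assms(2) by (intro Qform_rotation) (auto simp: rotation_matrix_def)
    also have "\<dots> = (\<Sum>k\<in>UNIV. D t $ k $ i * M t $ k $ j - D t $ k $ j * M t $ k $ i)"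
      by (rule Qform_entries[where D="\<lambda>k j. D t $ k $ j", OF D[OF that]])
    finally show ?thesis .
  qed
  have cs: "cos (\<theta> t) * (cos (\<theta> t) * u) = u - sin (\<theta> t) * (sin (\<theta> t) * u)" for t u
    using sin_cos_squared_add[of "\<theta> t"] by algebra
  have cs': "cos (\<theta> t) * cos (\<theta> t) = 1 - sin (\<theta> t) * sin (\<theta> t)" for t
    using cs[of t 1] by simp
  have minors: "minor3 (normal_form R \<theta> b11 b12 b13 b14 b22 b23) 1 2 3 t = 1"
      "minor3 (normal_form R \<theta> b11 b12 b13 b14 b22 b23) 1 2 4 t = 0"
      "minor3 (normal_form R \<theta> b11 b12 b13 b14 b22 b23) 1 3 4 t = 0" if "t \<in> I" for t
  proof -
    have "b11 t * b22 t * b33 t = 1" using nz[OF that] by (simp add: b33_def)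
    then show "minor3 (normal_form R \<theta> b11 b12 b13 b14 b22 b23) 1 2 3 t = 1"
      unfolding nf minor3_rotation[OF assms(2)] minor3_eq_det det_3
      by (simp add: column_def M) (simp add: algebra_simps cs cs')
    show "minor3 (normal_form R \<theta> b11 b12 b13 b14 b22 b23) 1 2 4 t = 0"
      "minor3 (normal_form R \<theta> b11 b12 b13 b14 b22 b23) 1 3 4 t = 0"
      unfolding nf minor3_rotation[OF assms(2)] minor3_eq_det det_3
      by (simp_all add: column_def M)
  qed
  have Q23: "Qform (normal_form R \<theta> b11 b12 b13 b14 b22 b23) 2 3 t =
      deriv b12 t * b13 t - deriv b13 t * b12 t
        + (deriv b22 t * b23 t - deriv b23 t * b22 t) + 2 * deriv \<theta> t / b11 t" if "t \<in> I" for t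
  proof -
    have "b22 t * b33 t = 1 / b11 t" using nz[OF that] by (simp add: b33_def)
    then have *: "2 * deriv \<theta> t / b11 t = 2 * deriv \<theta> t * (b22 t * b33 t)" by simp
    show ?thesis unfolding Q[OF that] sum_3 * M
      by (simp add: D_def vector_4) (simp add: algebra_simps cs cs')
  qed
  have Q': "Qform (normal_form R \<theta> b11 b12 b13 b14 b22 b23) 1 2 t = deriv b11 t * b12 t - deriv b12 t * b11 t"
    "Qform (normal_form R \<theta> b11 b12 b13 b14 b22 b23) 1 3 t = deriv b11 t * b13 t - deriv b13 t * b11 t"
    "Qform (normal_form R \<theta> b11 b12 b13 b14 b22 b23) 1 4 t = deriv b11 t * b14 t - deriv b14 t * b11 t"
    "Qform (normal_form R \<theta> b11 b12 b13 b14 b22 b23) 2 4 t = deriv b12 t * b14 t - deriv b14 t * b12 t"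
    "Qform (normal_form R \<theta> b11 b12 b13 b14 b22 b23) 3 4 t = deriv b13 t * b14 t - deriv b14 t * b13 t"
    if "t \<in> I" for t
    unfolding Q[OF that] sum_3 M by (simp_all add: D_def vector_4)
  show ?thesis unfolding time_conditions_def wronskian_equations_def
    by (intro ball_cong refl) (simp add: minors Q23 Q' conj_ac)
qed

text \<open>
  Write \<open>W\<^sub>i\<^sub>j\<close> for the Wronskian of the entries \<open>i\<close> and \<open>j\<close> of the first row. Each entry is a
  combination of \<open>b\<^sub>1\<^sub>1\<close> and \<open>b\<^sub>1\<^sub>4\<close> with Wronskians as coefficients, for example
  \<open>W\<^sub>1\<^sub>4 b\<^sub>1\<^sub>2 = W\<^sub>2\<^sub>4 b\<^sub>1\<^sub>1 + W\<^sub>1\<^sub>2 b\<^sub>1\<^sub>4\<close>, and this gives the formulas for \<open>b\<^sub>1\<^sub>2\<close> and \<open>b\<^sub>1\<^sub>3\<close>.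
  The Pluecker relation \<open>W\<^sub>1\<^sub>4 W\<^sub>2\<^sub>3 = W\<^sub>1\<^sub>3 W\<^sub>2\<^sub>4 - W\<^sub>1\<^sub>2 W\<^sub>3\<^sub>4\<close> eliminates \<open>W\<^sub>2\<^sub>3\<close> from the last
  equation, which becomes the differential equation for \<open>b\<^sub>2\<^sub>3\<close>. Conversely the formulas can be
  differentiated, since they hold on an open set.
\<close>

lemma wronskian_equations_iff_dependent_data:
  fixes \<theta> b11 b12 b13 b14 b22 b23 :: "real \<Rightarrow> real"
  assumes "open I" "c 1 4 \<noteq> 0"
    and smooth: "smooth_on I b11" "smooth_on I b12" "smooth_on I b13" "smooth_on I b14" "smooth_on I b23"
    and nz: "\<And>t. t \<in> I \<Longrightarrow> b11 t \<noteq> 0" "\<And>t. t \<in> I \<Longrightarrow> b22 t \<noteq> 0"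
  shows "wronskian_equations I c \<theta> b11 b12 b13 b14 b22 b23
    \<longleftrightarrow> dependent_data I c \<theta> b11 b12 b13 b14 b22 b23"
proof -
  define W where "W t \<longleftrightarrow>
      deriv b11 t * b12 t - deriv b12 t * b11 t = c 1 2 \<and>
      deriv b11 t * b13 t - deriv b13 t * b11 t = c 1 3 \<and>
      deriv b11 t * b14 t - deriv b14 t * b11 t = c 1 4 \<and>
      deriv b12 t * b14 t - deriv b14 t * b12 t = c 2 4 \<and>
      deriv b13 t * b14 t - deriv b14 t * b13 t = c 3 4 \<and>
      deriv b12 t * b13 t - deriv b13 t * b12 t
        + (deriv b22 t * b23 t - deriv b23 t * b22 t) + 2 * deriv \<theta> t / b11 t = c 2 3" for t
  define E where "E t \<longleftrightarrow> b14 t * deriv b11 t - b11 t * deriv b14 t = c 1 4 \<and>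
      b12 t = (c 2 4 * b11 t + c 1 2 * b14 t) / c 1 4 \<and>
      b13 t = (c 3 4 * b11 t + c 1 3 * b14 t) / c 1 4 \<and>
      deriv b23 t = (b11 t * b23 t * deriv b22 t + 2 * deriv \<theta> t) / (b11 t * b22 t)
        - (c 2 3 + (c 1 2 * c 3 4 - c 1 3 * c 2 4) / c 1 4) * (1 / b22 t)" for t
  have ode: "deriv b23 t = (b11 t * b23 t * deriv b22 t + 2 * deriv \<theta> t) / (b11 t * b22 t)
        - (c 2 3 + (c 1 2 * c 3 4 - c 1 3 * c 2 4) / c 1 4) * (1 / b22 t) \<longleftrightarrow>
      (c 1 3 * c 2 4 - c 1 2 * c 3 4) / c 1 4
        + (deriv b22 t * b23 t - deriv b23 t * b22 t) + 2 * deriv \<theta> t / b11 t = c 2 3"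
    if "t \<in> I" for t
  proof -
    have *: "(b11 t * b23 t * deriv b22 t + 2 * deriv \<theta> t) / (b11 t * b22 t)
        - (c 2 3 + (c 1 2 * c 3 4 - c 1 3 * c 2 4) / c 1 4) * (1 / b22 t)
      = ((c 1 3 * c 2 4 - c 1 2 * c 3 4) / c 1 4 + deriv b22 t * b23 t
          + 2 * deriv \<theta> t / b11 t - c 2 3) / b22 t"
      using nz[OF that] assms(2) by (simp add: field_simps)
    show ?thesis unfolding * eq_divide_eq using nz(2)[OF that] by auto
  qed
  have WE: "E t" if "t \<in> I" "W t" for t
  proof -
    have w: "deriv b11 t * b12 t - deriv b12 t * b11 t = c 1 2"
      "deriv b11 t * b13 t - deriv b13 t * b11 t = c 1 3"
      "deriv b11 t * b14 t - deriv b14 t * b11 t = c 1 4"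
      "deriv b12 t * b14 t - deriv b14 t * b12 t = c 2 4"
      "deriv b13 t * b14 t - deriv b14 t * b13 t = c 3 4"
      "deriv b12 t * b13 t - deriv b13 t * b12 t
        + (deriv b22 t * b23 t - deriv b23 t * b22 t) + 2 * deriv \<theta> t / b11 t = c 2 3"
      using that(2) by (simp_all add: W_def)
    have "c 1 4 * (deriv b12 t * b13 t - deriv b13 t * b12 t) = c 1 3 * c 2 4 - c 1 2 * c 3 4"
      unfolding w(1-5)[symmetric] by algebra
    then have "deriv b12 t * b13 t - deriv b13 t * b12 t = (c 1 3 * c 2 4 - c 1 2 * c 3 4) / c 1 4"
      using assms(2) by (simp add: field_simps)
    with w(6) have o: "(c 1 3 * c 2 4 - c 1 2 * c 3 4) / c 1 4
        + (deriv b22 t * b23 t - deriv b23 t * b22 t) + 2 * deriv \<theta> t / b11 t = c 2 3" by simp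
    have "c 1 4 * b12 t = c 2 4 * b11 t + c 1 2 * b14 t" "c 1 4 * b13 t = c 3 4 * b11 t + c 1 3 * b14 t"
      unfolding w(1-5)[symmetric] by algebra+
    then show ?thesis
      unfolding E_def ode[OF that(1)] using o w(3) assms(2) by (simp add: field_simps)
  qed
  have EW: "W t" if "t \<in> I" "\<And>s. s \<in> I \<Longrightarrow> E s" for t
  proof -
    have d: "deriv f t = (k * deriv b11 t + m * deriv b14 t) / c 1 4"
      if f: "\<And>s. s \<in> I \<Longrightarrow> f s = (k * b11 s + m * b14 s) / c 1 4" "smooth_on I f" for f k m
    proof (rule DERIV_imp_deriv)
      have "((\<lambda>s. (k * b11 s + m * b14 s) / c 1 4)
          has_real_derivative (k * deriv b11 t + m * deriv b14 t) / c 1 4) (at t)"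
        using smooth(1,4)[THEN smooth_on_has_real_derivative, OF \<open>t \<in> I\<close>]
        by (intro DERIV_cdivide DERIV_add DERIV_cmult)
      then show "(f has_real_derivative (k * deriv b11 t + m * deriv b14 t) / c 1 4) (at t)"
        by (rule has_field_derivative_transform_within_open[OF _ assms(1) \<open>t \<in> I\<close>]) (simp add: f(1))
    qed
    have e: "b14 s * deriv b11 s - b11 s * deriv b14 s = c 1 4"
        "b12 s = (c 2 4 * b11 s + c 1 2 * b14 s) / c 1 4"
        "b13 s = (c 3 4 * b11 s + c 1 3 * b14 s) / c 1 4" if "s \<in> I" for s
      using \<open>\<And>s. s \<in> I \<Longrightarrow> E s\<close>[OF that] by (simp_all add: E_def)
    note w14 = e(1)[OF that(1)]
    note d12 = d[OF e(2) smooth(2)] and d13 = d[OF e(3) smooth(3)]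
    have lin: "c 1 4 * deriv b12 t = c 2 4 * deriv b11 t + c 1 2 * deriv b14 t"
      "c 1 4 * deriv b13 t = c 3 4 * deriv b11 t + c 1 3 * deriv b14 t"
      "c 1 4 * b12 t = c 2 4 * b11 t + c 1 2 * b14 t"
      "c 1 4 * b13 t = c 3 4 * b11 t + c 1 3 * b14 t"
      using assms(2) by (simp_all add: d12 d13 e(2,3)[OF that(1)])
    have "c 1 4 * (deriv b11 t * b12 t - deriv b12 t * b11 t) = c 1 4 * c 1 2"
      "c 1 4 * (deriv b11 t * b13 t - deriv b13 t * b11 t) = c 1 4 * c 1 3"
      "c 1 4 * (deriv b12 t * b14 t - deriv b14 t * b12 t) = c 1 4 * c 2 4"
      "c 1 4 * (deriv b13 t * b14 t - deriv b14 t * b13 t) = c 1 4 * c 3 4"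
      using lin w14 by algebra+
    then have w: "deriv b11 t * b12 t - deriv b12 t * b11 t = c 1 2"
      "deriv b11 t * b13 t - deriv b13 t * b11 t = c 1 3"
      "deriv b12 t * b14 t - deriv b14 t * b12 t = c 2 4"
      "deriv b13 t * b14 t - deriv b14 t * b13 t = c 3 4"
      using assms(2) by simp_all
    have "c 1 4 * (deriv b12 t * b13 t - deriv b13 t * b12 t) = c 1 3 * c 2 4 - c 1 2 * c 3 4"
      unfolding w[symmetric] w14[symmetric] by algebra
    then have "deriv b12 t * b13 t - deriv b13 t * b12 t = (c 1 3 * c 2 4 - c 1 2 * c 3 4) / c 1 4"
      using assms(2) by (simp add: field_simps)
    moreover have "(c 1 3 * c 2 4 - c 1 2 * c 3 4) / c 1 4
        + (deriv b22 t * b23 t - deriv b23 t * b22 t) + 2 * deriv \<theta> t / b11 t = c 2 3"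
      using \<open>\<And>s. s \<in> I \<Longrightarrow> E s\<close>[OF that(1)] unfolding E_def ode[OF that(1)] by blast
    ultimately show ?thesis using w w14 by (simp add: W_def mult.commute)
  qed
  have "dependent_data I c \<theta> b11 b12 b13 b14 b22 b23 \<longleftrightarrow> (\<forall>t\<in>I. E t)"
    unfolding dependent_data_def E_def using smooth by simp
  also have "\<dots> \<longleftrightarrow> (\<forall>t\<in>I. W t)" using WE EW by blast
  also have "\<dots> \<longleftrightarrow> wronskian_equations I c \<theta> b11 b12 b13 b14 b22 b23"
    unfolding W_def wronskian_equations_def ..
  finally show ?thesis ..
qed

corollary time_conditions_normal_form_iff_dependent_data:
  fixes \<theta> b11 b12 b13 b14 b22 b23 :: "real \<Rightarrow> real"
  assumes "open I" "rotation_matrix R" "c 1 4 \<noteq> 0" "free_data I \<theta> b11 b22"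
    and "smooth_on I b12" "smooth_on I b13" "smooth_on I b14" "smooth_on I b23"
  shows "time_conditions I c (normal_form R \<theta> b11 b12 b13 b14 b22 b23)
    \<longleftrightarrow> dependent_data I c \<theta> b11 b12 b13 b14 b22 b23"
proof -
  have f: "smooth_on I \<theta>" "smooth_on I b11" "smooth_on I b22"
    "\<And>t. t \<in> I \<Longrightarrow> b11 t \<noteq> 0" "\<And>t. t \<in> I \<Longrightarrow> b22 t \<noteq> 0"
    using assms(4) by (auto simp: free_data_def)
  have "time_conditions I c (normal_form R \<theta> b11 b12 b13 b14 b22 b23)
      \<longleftrightarrow> wronskian_equations I c \<theta> b11 b12 b13 b14 b22 b23"
    by (intro time_conditions_normal_form_iff assms f)
  also have "\<dots> \<longleftrightarrow> dependent_data I c \<theta> b11 b12 b13 b14 b22 b23"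
    by (intro wronskian_equations_iff_dependent_data assms f)
  finally show ?thesis .
qed

text \<open>
  Both differential equations are linear of first order, and homogeneous solutions are at hand:
  \<open>b\<^sub>1\<^sub>1\<close> for \<open>b\<^sub>1\<^sub>4\<close> and \<open>b\<^sub>2\<^sub>2\<close> for \<open>b\<^sub>2\<^sub>3\<close>. Variation of constants leaves two antiderivatives, \<open>G\<close> and
  \<open>H\<close>.
\<close>

lemma dependent_data_exists:
  fixes \<theta> b11 b22 :: "real \<Rightarrow> real"
  assumes "open I" "is_interval I" "c 1 4 \<noteq> 0" "free_data I \<theta> b11 b22"
  shows "\<exists>b12 b13 b14 b23. dependent_data I c \<theta> b11 b12 b13 b14 b22 b23"
proof -
  have f: "smooth_on I \<theta>" "smooth_on I b11" "smooth_on I b22"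
    "\<And>t. t \<in> I \<Longrightarrow> b11 t \<noteq> 0" "\<And>t. t \<in> I \<Longrightarrow> b22 t \<noteq> 0"
    using assms(4) by (auto simp: free_data_def)
  note sm = smooth_on_arith[OF assms(1)] f(1-3) smooth_on_deriv[OF assms(1)]
  define K where "K = c 2 3 + (c 1 2 * c 3 4 - c 1 3 * c 2 4) / c 1 4"
  obtain G where G: "smooth_on I G" "\<And>t. t \<in> I \<Longrightarrow> (G has_real_derivative 1 / (b11 t * b11 t)) (at t)"
    by (rule smooth_antiderivative[OF assms(1,2), of "\<lambda>t. 1 / (b11 t * b11 t)"])
      (use f(4) in \<open>auto intro!: sm\<close>)
  obtain H where H: "smooth_on I H"
    "\<And>t. t \<in> I \<Longrightarrow> (H has_real_derivative
      (2 * deriv \<theta> t / (b11 t * b22 t) - K / b22 t) / b22 t) (at t)"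
    by (rule smooth_antiderivative[OF assms(1,2), of "\<lambda>t. (2 * deriv \<theta> t / (b11 t * b22 t) - K / b22 t) / b22 t"])
      (use f(4,5) in \<open>auto intro!: sm\<close>)
  define b14 where "b14 t = - c 1 4 * (b11 t * G t)" for t
  define b23 where "b23 t = b22 t * H t" for t
  have s: "smooth_on I b14" "smooth_on I b23"
    unfolding b14_def b23_def using G(1) H(1) by (auto intro!: sm)
  have d14: "deriv b14 t = - c 1 4 * (deriv b11 t * G t + 1 / (b11 t * b11 t) * b11 t)" if "t \<in> I" for t
    unfolding b14_def[abs_def]
    by (rule DERIV_imp_deriv, rule DERIV_cmult, rule DERIV_mult[OF smooth_on_has_real_derivative[OF f(2) that] G(2)[OF that]])
  have d23: "deriv b23 t = deriv b22 t * H t + (2 * deriv \<theta> t / (b11 t * b22 t) - K / b22 t) / b22 t * b22 t"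
    if "t \<in> I" for t
    unfolding b23_def[abs_def]
    by (rule DERIV_imp_deriv, rule DERIV_mult[OF smooth_on_has_real_derivative[OF f(3) that] H(2)[OF that]])
  have "dependent_data I c \<theta> b11 (\<lambda>t. (c 2 4 * b11 t + c 1 2 * b14 t) / c 1 4)
      (\<lambda>t. (c 3 4 * b11 t + c 1 3 * b14 t) / c 1 4) b14 b22 b23"
    unfolding dependent_data_def K_def[symmetric]
  proof (intro conjI ballI refl s)
    show "smooth_on I (\<lambda>t. (c 2 4 * b11 t + c 1 2 * b14 t) / c 1 4)"
      "smooth_on I (\<lambda>t. (c 3 4 * b11 t + c 1 3 * b14 t) / c 1 4)"
      using assms(3) by (auto intro!: sm s)
    fix t assume t: "t \<in> I"
    show "b14 t * deriv b11 t - b11 t * deriv b14 t = c 1 4"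
      unfolding d14[OF t] b14_def using f(4)[OF t] by (simp add: field_simps)
    show "deriv b23 t = (b11 t * b23 t * deriv b22 t + 2 * deriv \<theta> t) / (b11 t * b22 t) - K * (1 / b22 t)"
      unfolding d23[OF t] b23_def using f(4,5)[OF t] by (simp add: field_simps)
  qed
  then show ?thesis by blast
qed

section \<open>Smooth polar coordinates\<close>

text \<open>
  The angle is an antiderivative of \<open>(x y' - y x') / (x\<^sup>2 + y\<^sup>2)\<close>, normalised at one point. In the frame
  rotated by this angle the curve has coordinates \<open>(p, q)\<close>, and the choice of the angle makes
  \<open>q\<^sup>2 / (x\<^sup>2 + y\<^sup>2)\<close> constant; it is zero at the base point, hence everywhere. The radius \<open>p\<close> is a
  polynomial in \<open>x\<close>, \<open>y\<close>, \<open>cos \<theta>\<close> and \<open>sin \<theta>\<close>, so its smoothness is immediate.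
\<close>

lemma smooth_polar_coordinates:
  fixes x y :: "real \<Rightarrow> real"
  assumes "open I" "is_interval I" "smooth_on I x" "smooth_on I y"
    and nz: "\<And>t. t \<in> I \<Longrightarrow> (x t)\<^sup>2 + (y t)\<^sup>2 \<noteq> 0"
  obtains \<theta> p where "smooth_on I \<theta>" "smooth_on I p"
    "\<And>t. t \<in> I \<Longrightarrow> x t = p t * cos (\<theta> t)" "\<And>t. t \<in> I \<Longrightarrow> y t = p t * sin (\<theta> t)"
proof (cases "I = {}")
  case True
  then show ?thesis using that[of x x] assms(3) by simp
next
  case False
  then obtain t0 where t0: "t0 \<in> I" by blast
  define r where "r t = x t * x t + y t * y t" for t
  have r: "r t \<noteq> 0" if "t \<in> I" for t using nz[OF that] by (simp add: r_def power2_eq_square)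
  note sm = smooth_on_arith[OF assms(1)] assms(3,4) smooth_on_deriv[OF assms(1)]
  have "smooth_on I (\<lambda>t. (x t * deriv y t - y t * deriv x t) / r t)"
    using r unfolding r_def by (intro sm) auto
  then obtain \<theta>1 where \<theta>1: "smooth_on I \<theta>1"
    "\<And>t. t \<in> I \<Longrightarrow> (\<theta>1 has_real_derivative (x t * deriv y t - y t * deriv x t) / r t) (at t)"
    by (rule smooth_antiderivative[OF assms(1,2)]) auto
  obtain \<rho> \<alpha> where polar: "x t0 = \<rho> * cos \<alpha>" "y t0 = \<rho> * sin \<alpha>" using polar_Ex by blast
  define \<theta> where "\<theta> t = \<theta>1 t + (\<alpha> - \<theta>1 t0)" for t
  have \<theta>: "smooth_on I \<theta>" unfolding \<theta>_def by (intro sm \<theta>1)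
  have d\<theta>: "(\<theta> has_real_derivative (x t * deriv y t - y t * deriv x t) / r t) (at t)" if "t \<in> I" for t
    unfolding \<theta>_def[abs_def] using \<theta>1(2)[OF that] by (auto intro!: derivative_eq_intros)
  define p where "p t = x t * cos (\<theta> t) + y t * sin (\<theta> t)" for t
  define q where "q t = y t * cos (\<theta> t) - x t * sin (\<theta> t)" for t
  have p: "smooth_on I p" unfolding p_def by (intro sm \<theta>)
  have cs: "cos (\<theta> t) * cos (\<theta> t) + sin (\<theta> t) * sin (\<theta> t) = 1" for t
    using sin_cos_squared_add[of "\<theta> t"] by (simp add: power2_eq_square)
  have xy: "x t = p t * cos (\<theta> t) - q t * sin (\<theta> t)" "y t = p t * sin (\<theta> t) + q t * cos (\<theta> t)" for t
    using cs[of t] unfolding p_def q_def by algebra+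
  have "((\<lambda>s. q s * q s / r s) has_real_derivative 0) (at t within I)" if t: "t \<in> I" for t
  proof -
    \<comment> \<open>\<open>w\<close> and \<open>q'\<close> are the derivatives of \<open>\<theta>\<close> and \<open>q\<close>. With \<open>x, y\<close> expressed by \<open>p, q\<close> one finds that
      \<open>q' / q\<close> is half the logarithmic derivative of \<open>r = p\<^sup>2 + q\<^sup>2\<close>, stated without division by \<open>q\<close>.\<close>
    define w where "w = (x t * deriv y t - y t * deriv x t) / r t"
    note d = smooth_on_has_real_derivative[OF assms(3) t] smooth_on_has_real_derivative[OF assms(4) t]
      d\<theta>[OF t, folded w_def]
    define q' where "q' = deriv y t * cos (\<theta> t) - deriv x t * sin (\<theta> t) - w * p t"
    have dq: "(q has_real_derivative q') (at t)"
      unfolding q_def[abs_def] q'_def p_def using d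
      by (auto intro!: derivative_eq_intros simp: algebra_simps)
    have dr: "(r has_real_derivative 2 * (x t * deriv x t + y t * deriv y t)) (at t)"
      unfolding r_def[abs_def] using d by (auto intro!: derivative_eq_intros simp: algebra_simps)
    have w: "w * r t = x t * deriv y t - y t * deriv x t" using r[OF t] by (simp add: w_def)
    have "r t = p t * p t + q t * q t"
      using cs[of t] unfolding r_def xy[of t] by algebra
    then have "q' * r t = q t * (x t * deriv x t + y t * deriv y t)"
      using w cs[of t] unfolding q'_def xy[of t] by algebra
    then have "(q' * q t + q' * q t) * r t - (q t * q t) * (2 * (x t * deriv x t + y t * deriv y t)) = 0"
      by algebra
    then have "((q' * q t + q' * q t) * r t - (q t * q t) * (2 * (x t * deriv x t + y t * deriv y t)))
        / (r t * r t) = 0" by (simp only: div_0)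
    with DERIV_divide[OF DERIV_mult[OF dq dq] dr r[OF t]]
    have "((\<lambda>s. q s * q s / r s) has_real_derivative 0) (at t)" by (rule DERIV_cong)
    then show ?thesis by (rule has_field_derivative_at_within)
  qed
  then obtain k where k: "\<And>t. t \<in> I \<Longrightarrow> q t * q t / r t = k"
    using has_field_derivative_zero_constant[of I "\<lambda>s. q s * q s / r s"] assms(2)
    by (auto simp: is_interval_convex)
  have "q t0 = 0" by (simp add: q_def \<theta>_def polar)
  with k[OF t0] have "k = 0" by simp
  then have "q t = 0" if "t \<in> I" for t using k[OF that] r[OF that] by simp
  with xy show ?thesis by (intro that[OF \<theta> p]) auto
qed

section \<open>The first column has a constant direction\<close>

text \<open>
  Here \<open>l a\<close> is the fourth column. Expanding the second condition and inserting the first gives the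
  first conclusion. Differentiating that, and replacing \<open>m\<close> by its expression in the derivatives of
  \<open>a\<close> and \<open>x\<close>, cancels the terms with the derivative of \<open>x\<close>: what is left is an orthogonality
  relation between \<open>x\<close> and a vector that depends on \<open>a\<close> and \<open>l\<close> alone.
\<close>

lemma inner_with_first_column:
  fixes a x :: "real \<Rightarrow> 'a::real_inner"
  assumes "open I"
    and smooth: "smooth_on I a" "smooth_on I x" "smooth_on I l"
    and m: "\<And>t. t \<in> I \<Longrightarrow> vector_derivative a (at t) \<bullet> x t - vector_derivative x (at t) \<bullet> a t = m"
    and k: "\<And>t. t \<in> I \<Longrightarrow> vector_derivative x (at t) \<bullet> (l t *\<^sub>R a t)
        - vector_derivative (\<lambda>s. l s *\<^sub>R a s) (at t) \<bullet> x t = k"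
    and "t \<in> I"
  shows "deriv l t * (a t \<bullet> x t) = - k - l t * m"
    and "(2 * deriv l t) *\<^sub>R vector_derivative a (at t) \<bullet> x t
        + deriv (deriv l) t *\<^sub>R a t \<bullet> x t = 0"
proof -
  let ?a' = "\<lambda>t. vector_derivative a (at t)" and ?x' = "\<lambda>t. vector_derivative x (at t)"
  have e: "deriv l s * (a s \<bullet> x s) = - k - l s * m" if s: "s \<in> I" for s
  proof -
    have "((\<lambda>s. l s *\<^sub>R a s) has_vector_derivative l s *\<^sub>R ?a' s + deriv l s *\<^sub>R a s) (at s)"
      by (rule has_vector_derivative_scaleR[OF smooth_on_has_real_derivative[OF smooth(3) s]
            smooth_on_has_vector_derivative[OF smooth(1) s]])
    then have "vector_derivative (\<lambda>s. l s *\<^sub>R a s) (at s) = l s *\<^sub>R ?a' s + deriv l s *\<^sub>R a s"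
      by (rule vector_derivative_at)
    with k[OF s] have "?x' s \<bullet> (l s *\<^sub>R a s) - (l s *\<^sub>R ?a' s + deriv l s *\<^sub>R a s) \<bullet> x s = k"
      by simp
    then have "l s * (?x' s \<bullet> a s) - l s * (?a' s \<bullet> x s) - deriv l s * (a s \<bullet> x s) = k"
      by (simp add: inner_add_left)
    moreover have "l s * (?a' s \<bullet> x s) - l s * (?x' s \<bullet> a s) = l s * m"
      unfolding m[OF s, symmetric] by (rule right_diff_distrib[symmetric])
    ultimately show ?thesis by linarith
  qed
  show "deriv l t * (a t \<bullet> x t) = - k - l t * m" using e \<open>t \<in> I\<close> .
  have "((\<lambda>s. a s \<bullet> x s) has_real_derivative a t \<bullet> ?x' t + ?a' t \<bullet> x t) (at t)"
    unfolding has_real_derivative_iff_has_vector_derivative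
    by (rule bounded_bilinear.has_vector_derivative[OF bounded_bilinear_inner])
      (rule smooth_on_has_vector_derivative[OF _ \<open>t \<in> I\<close>], rule smooth)+
  then have "((\<lambda>s. deriv l s * (a s \<bullet> x s)) has_real_derivative
      deriv (deriv l) t * (a t \<bullet> x t) + (a t \<bullet> ?x' t + ?a' t \<bullet> x t) * deriv l t) (at t)"
    by (rule DERIV_mult[OF smooth_on_has_real_derivative[OF smooth_on_deriv[OF assms(1) smooth(3)] \<open>t \<in> I\<close>]])
  moreover have "((\<lambda>s. - k - l s * m) has_real_derivative - (deriv l t * m)) (at t)"
    using smooth_on_has_real_derivative[OF smooth(3) \<open>t \<in> I\<close>] by (auto intro!: derivative_eq_intros)
  then have "((\<lambda>s. deriv l s * (a s \<bullet> x s)) has_real_derivative - (deriv l t * m)) (at t)"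
    by (rule has_field_derivative_transform_within_open[OF _ assms(1) \<open>t \<in> I\<close>]) (simp add: e)
  ultimately have "deriv (deriv l) t * (a t \<bullet> x t) + (a t \<bullet> ?x' t + ?a' t \<bullet> x t) * deriv l t
      = - (deriv l t * m)"
    by (rule DERIV_unique)
  moreover have "?a' t \<bullet> x t - a t \<bullet> ?x' t = m" using m[OF \<open>t \<in> I\<close>] by (simp add: inner_commute)
  ultimately have "2 * deriv l t * (?a' t \<bullet> x t) + deriv (deriv l) t * (a t \<bullet> x t) = 0"
    by algebra
  then show "(2 * deriv l t) *\<^sub>R ?a' t \<bullet> x t + deriv (deriv l) t *\<^sub>R a t \<bullet> x t = 0" by simp
qed

text \<open>
  Under the equation \<open>a' = \<mu> a\<close> the norm satisfies the same equation, so \<open>a / |a|\<close> has derivative zero.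
\<close>

lemma constant_direction:
  fixes a :: "real \<Rightarrow> 'a::real_inner"
  assumes "convex I" "t0 \<in> I"
    and deriv: "\<And>t. t \<in> I \<Longrightarrow> (a has_vector_derivative \<mu> t *\<^sub>R a t) (at t)"
    and nz: "\<And>t. t \<in> I \<Longrightarrow> a t \<noteq> 0"
  obtains u where "norm u = 1" "\<And>t. t \<in> I \<Longrightarrow> a t = norm (a t) *\<^sub>R u"
proof -
  have "((\<lambda>s. inverse (norm (a s)) *\<^sub>R a s) has_vector_derivative 0) (at t within I)" if t: "t \<in> I" for t
  proof -
    have d: "((\<lambda>s. a s \<bullet> a s) has_real_derivative a t \<bullet> (\<mu> t *\<^sub>R a t) + (\<mu> t *\<^sub>R a t) \<bullet> a t) (at t)"
      unfolding has_real_derivative_iff_has_vector_derivative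
      by (rule bounded_bilinear.has_vector_derivative[OF bounded_bilinear_inner deriv[OF t] deriv[OF t]])
    have pos: "a t \<bullet> a t > 0" using nz[OF t] by simp
    have "((\<lambda>s. sqrt (a s \<bullet> a s)) has_real_derivative
        (inverse (sqrt (a t \<bullet> a t)) / 2) * (a t \<bullet> (\<mu> t *\<^sub>R a t) + (\<mu> t *\<^sub>R a t) \<bullet> a t)) (at t)"
      by (rule DERIV_chain2[OF DERIV_real_sqrt[OF pos] d])
    moreover have "(inverse (sqrt (a t \<bullet> a t)) / 2) * (a t \<bullet> (\<mu> t *\<^sub>R a t) + (\<mu> t *\<^sub>R a t) \<bullet> a t)
        = \<mu> t * norm (a t)"
      using nz[OF t] by (simp add: norm_eq_sqrt_inner[symmetric] power2_norm_eq_inner[symmetric] power2_eq_square)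
    ultimately have "((\<lambda>s. sqrt (a s \<bullet> a s)) has_real_derivative \<mu> t * norm (a t)) (at t)"
      by (rule DERIV_cong)
    then have "((\<lambda>s. norm (a s)) has_real_derivative \<mu> t * norm (a t)) (at t)"
      unfolding norm_eq_sqrt_inner .
    then have "((\<lambda>s. inverse (norm (a s))) has_real_derivative
        - (inverse (norm (a t)) * (\<mu> t * norm (a t)) * inverse (norm (a t)))) (at t)"
      using nz[OF t] by (intro DERIV_inverse') auto
    then have "((\<lambda>s. inverse (norm (a s)) *\<^sub>R a s) has_vector_derivative
        inverse (norm (a t)) *\<^sub>R (\<mu> t *\<^sub>R a t)
        + (- (inverse (norm (a t)) * (\<mu> t * norm (a t)) * inverse (norm (a t)))) *\<^sub>R a t) (at t)"
      by (rule has_vector_derivative_scaleR) (rule deriv[OF t])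
    moreover have "inverse (norm (a t)) *\<^sub>R (\<mu> t *\<^sub>R a t)
        + (- (inverse (norm (a t)) * (\<mu> t * norm (a t)) * inverse (norm (a t)))) *\<^sub>R a t = 0"
      using nz[OF t] by (simp add: field_simps)
    ultimately have "((\<lambda>s. inverse (norm (a s)) *\<^sub>R a s) has_vector_derivative 0) (at t)"
      by (simp only:)
    then show ?thesis by (rule has_vector_derivative_at_within)
  qed
  then obtain u where u: "\<And>t. t \<in> I \<Longrightarrow> inverse (norm (a t)) *\<^sub>R a t = u"
    using has_vector_derivative_zero_constant[OF assms(1)] by blast
  show thesis
  proof
    have "norm (inverse (norm (a t0)) *\<^sub>R a t0) = 1" using nz[OF assms(2)] by simp
    then show "norm u = 1" by (simp only: u[OF assms(2)])
    show "a t = norm (a t) *\<^sub>R u" if "t \<in> I" for t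
      unfolding u[OF that, symmetric] using nz[OF that] by simp
  qed
qed

lemma smooth_on_columns:
  fixes A :: "real \<Rightarrow> real^'n^'m"
  assumes "open I" "smooth_on I A"
  shows "smooth_on I (\<lambda>t. column j (A t))"
proof (rule smooth_on_bounded_linear[OF assms(1) _ assms(2)])
  have "linear (\<lambda>M :: real^'n^'m. column j M)"
    by (intro linearI) (simp_all add: column_def vec_eq_iff)
  then show "bounded_linear (\<lambda>M :: real^'n^'m. column j M)" by (rule linear_conv_bounded_linear[THEN iffD1])
qed

text \<open>
  Columns 1, 2 and 3 span the space, so a vector vanishes as soon as it is orthogonal to them, and
  each of them yields such an orthogonality through \<open>inner_with_first_column\<close>; for the first column itself the constants are \<open>0\<close> and \<open>c\<^sub>1\<^sub>4\<close>.
\<close>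

lemma first_column_constant_direction:
  fixes A :: "real \<Rightarrow> real^4^3"
  assumes "open I" "is_interval I" "smooth_on I A" "columns_lin_indep I A" "time_conditions I c A"
  obtains u l where "c 1 4 \<noteq> 0" "norm u = 1"
    "\<And>t. t \<in> I \<Longrightarrow> column 1 (A t) = norm (column 1 (A t)) *\<^sub>R u"
    "\<And>t. t \<in> I \<Longrightarrow> column 4 (A t) = l t *\<^sub>R column 1 (A t)"
proof -
  define a b c' d where "a t = column 1 (A t)" and "b t = column 2 (A t)"
    and "c' t = column 3 (A t)" and "d t = column 4 (A t)" for t
  have smooth: "smooth_on I a" "smooth_on I b" "smooth_on I c'" "smooth_on I d"
    unfolding a_def[abs_def] b_def[abs_def] c'_def[abs_def] d_def[abs_def]
    by (rule smooth_on_columns[OF assms(1,3)])+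
  have dets: "det (vector [a t, b t, c' t] :: real^3^3) = 1" "det (vector [a t, b t, d t] :: real^3^3) = 0"
    "det (vector [a t, c' t, d t] :: real^3^3) = 0" if "t \<in> I" for t
    using assms(5) that by (simp_all add: time_conditions_def minor3_eq_det a_def b_def c'_def d_def)
  have Q: "vector_derivative a (at t) \<bullet> b t - vector_derivative b (at t) \<bullet> a t = c 1 2"
    "vector_derivative a (at t) \<bullet> c' t - vector_derivative c' (at t) \<bullet> a t = c 1 3"
    "vector_derivative a (at t) \<bullet> d t - vector_derivative d (at t) \<bullet> a t = c 1 4"
    "vector_derivative b (at t) \<bullet> d t - vector_derivative d (at t) \<bullet> b t = c 2 4"
    "vector_derivative c' (at t) \<bullet> d t - vector_derivative d (at t) \<bullet> c' t = c 3 4" if "t \<in> I" for t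
    using assms(5) that
    by (simp_all add: time_conditions_def Qform_def a_def[abs_def] b_def[abs_def] c'_def[abs_def] d_def[abs_def])
  have anz: "a t \<noteq> 0" if "t \<in> I" for t
    using dets(1)[OF that] by (auto simp: det_3)
  define l where "l t = (d t \<bullet> a t) / (a t \<bullet> a t)" for t
  have l: "smooth_on I l"
    unfolding l_def using anz
    by (intro smooth_on_divide smooth_on_inner assms(1) smooth) auto
  have d: "d t = l t *\<^sub>R a t" if "t \<in> I" for t
  proof -
    have "d t = det (vector [d t, b t, c' t]) *\<^sub>R a t"
    proof -
      have "det (vector [a t, d t, c' t] :: real^3^3) = - det (vector [a t, c' t, d t] :: real^3^3)"
        by (simp add: det_3)
      then show ?thesis using cramer_3[of "a t" "b t" "c' t" "d t"] dets[OF that] by simp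
    qed
    then obtain k where k: "d t = k *\<^sub>R a t" by blast
    then show ?thesis using anz[OF that] by (simp add: l_def)
  qed
  have d': "vector_derivative d (at t) = vector_derivative (\<lambda>s. l s *\<^sub>R a s) (at t)" if "t \<in> I" for t
    by (rule vector_derivative_cong_eq)
      (use eventually_nhds_in_open[OF assms(1) that] d in \<open>auto elim!: eventually_mono\<close>)
  note col = inner_with_first_column[OF assms(1) smooth(1) _ l]
  have eq_a: "deriv l t * (a t \<bullet> a t) = - c 1 4 - l t * 0"
    "(2 * deriv l t) *\<^sub>R vector_derivative a (at t) \<bullet> a t + deriv (deriv l) t *\<^sub>R a t \<bullet> a t = 0"
    if "t \<in> I" for t
    by (rule col[of a, OF smooth(1) _ _ that]; use Q(3) d d' in simp)+
  have eq_b: "(2 * deriv l t) *\<^sub>R vector_derivative a (at t) \<bullet> b t + deriv (deriv l) t *\<^sub>R a t \<bullet> b t = 0"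
    if "t \<in> I" for t
    by (rule col(2)[of b "c 1 2" "c 2 4", OF smooth(2) _ _ that]; use Q(1,4) d d' in simp)
  have eq_c: "(2 * deriv l t) *\<^sub>R vector_derivative a (at t) \<bullet> c' t + deriv (deriv l) t *\<^sub>R a t \<bullet> c' t = 0"
    if "t \<in> I" for t
    by (rule col(2)[of c' "c 1 3" "c 3 4", OF smooth(3) _ _ that]; use Q(2,5) d d' in simp)
  have nonempty: "I \<noteq> {}"
  proof
    assume "I = {}"
    with assms(4) have "\<forall>x :: 4 \<Rightarrow> real. \<forall>j. x j = 0" by (simp add: columns_lin_indep_def)
    from spec[OF this, of "\<lambda>_. 1"] show False by simp
  qed
  then obtain t0 where t0: "t0 \<in> I" by blast
  have c14: "c 1 4 \<noteq> 0"
  proof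
    assume "c 1 4 = 0"
    then have "deriv l t = 0" if "t \<in> I" for t using eq_a(1)[OF that] anz[OF that] by simp
    then have "(l has_real_derivative 0) (at t within I)" if "t \<in> I" for t
      using smooth_on_has_real_derivative[OF l that] that by (simp add: has_field_derivative_at_within)
    then obtain k where k: "\<And>t. t \<in> I \<Longrightarrow> l t = k"
      using has_field_derivative_zero_constant[of I l] assms(2) by (auto simp: is_interval_convex)
    \<comment> \<open>the coefficients of the relation \<open>A\<^sub>4 - k A\<^sub>1 = 0\<close>\<close>
    define x :: "4 \<Rightarrow> real" where "x j = (if j = 1 then - k else if j = 4 then 1 else 0)" for j
    have x: "x 1 = - k" "x 2 = 0" "x 3 = 0" "x 4 = 1" by (simp_all add: x_def)
    have "(\<Sum>j\<in>UNIV. x j *\<^sub>R column j (A t)) = 0" if "t \<in> I" for t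
      using d[OF that] k[OF that] by (simp add: sum_4 x a_def d_def)
    then have "x 4 = 0" using assms(4) unfolding columns_lin_indep_def by blast
    then show False by (simp add: x)
  qed
  have lnz: "deriv l t \<noteq> 0" if "t \<in> I" for t using eq_a(1)[OF that] c14 by auto
  have "(a has_vector_derivative (- deriv (deriv l) t / (2 * deriv l t)) *\<^sub>R a t) (at t)"
    if t: "t \<in> I" for t
  proof -
    have "(2 * deriv l t) *\<^sub>R vector_derivative a (at t) + deriv (deriv l) t *\<^sub>R a t = 0"
      by (rule orthogonal_to_basis_3[of "a t" "b t" "c' t"])
        (use dets(1)[OF t] in simp, unfold inner_add_left, fact eq_a(2)[OF t],
          fact eq_b[OF t], fact eq_c[OF t])
    then have "(2 * deriv l t) *\<^sub>R vector_derivative a (at t) = (- deriv (deriv l) t) *\<^sub>R a t"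
      by (simp add: eq_neg_iff_add_eq_0)
    then have "(1 / (2 * deriv l t)) *\<^sub>R ((2 * deriv l t) *\<^sub>R vector_derivative a (at t))
        = (1 / (2 * deriv l t)) *\<^sub>R ((- deriv (deriv l) t) *\<^sub>R a t)" by (rule arg_cong)
    then have "vector_derivative a (at t) = (- deriv (deriv l) t / (2 * deriv l t)) *\<^sub>R a t"
      using lnz[OF t] by simp
    then show ?thesis using smooth_on_has_vector_derivative[OF smooth(1) t] by simp
  qed
  then obtain u where "norm u = 1" "\<And>t. t \<in> I \<Longrightarrow> a t = norm (a t) *\<^sub>R u"
    by (rule constant_direction[OF is_interval_convex[OF assms(2)] t0, where a=a]) (simp_all add: anz)
  with c14 d show thesis by (intro that[of u l]) (simp_all add: a_def d_def)
qed

section \<open>Every solution has the normal form\<close>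

text \<open>
  \<open>B\<close> is \<open>A\<close> seen in a fixed frame whose first axis is the direction of the first column. The first
  row of \<open>B\<close> supplies the entries \<open>b\<^sub>1\<^sub>j\<close>, and \<open>b\<^sub>2\<^sub>3, b\<^sub>3\<^sub>3\<close> are the components of the third column
  along and across the second one in the orthogonal plane.
\<close>

lemma solution_has_normal_form:
  fixes A :: "real \<Rightarrow> real^4^3"
  assumes "open I" "is_interval I" "smooth_on I A" "columns_lin_indep I A" "time_conditions I c A"
  obtains R \<theta> b11 b12 b13 b14 b22 b23 where "c 1 4 \<noteq> 0" "rotation_matrix R" "free_data I \<theta> b11 b22"
    "dependent_data I c \<theta> b11 b12 b13 b14 b22 b23"
    "\<And>t. t \<in> I \<Longrightarrow> A t = normal_form R \<theta> b11 b12 b13 b14 b22 b23 t"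
proof -
  obtain u l where c14: "c 1 4 \<noteq> 0" and u: "norm u = 1"
      "\<And>t. t \<in> I \<Longrightarrow> column 1 (A t) = norm (column 1 (A t)) *\<^sub>R u"
    and l: "\<And>t. t \<in> I \<Longrightarrow> column 4 (A t) = l t *\<^sub>R column 1 (A t)"
    by (rule first_column_constant_direction[OF assms]) blast
  obtain R :: "real^3^3" where R: "rotation_matrix R" "R *v axis 1 1 = u"
    by (rule rotation_matrix_exists_basis[of u 1]) (use u(1) in auto)
  have orth: "transpose R ** R = mat 1" "R ** transpose R = mat 1"
    using R(1) by (auto simp: rotation_matrix_def orthogonal_matrix_def)
  define B where "B t = transpose R ** A t" for t
  have A: "A = (\<lambda>t. R ** B t)" by (simp add: B_def matrix_mul_assoc orth)
  have "bounded_linear (\<lambda>M :: real^4^3. transpose R ** M)"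
    by (intro linear_conv_bounded_linear[THEN iffD1] linearI)
      (simp_all add: matrix_add_ldistrib vec_eq_iff matrix_matrix_mult_def sum_distrib_left sum.distrib algebra_simps)
  then have "smooth_on I B"
    unfolding B_def by (rule smooth_on_bounded_linear[OF assms(1) _ assms(3)])
  note sB = smooth_on_entry[OF assms(1) this]
  have col1: "column 1 (B t) = norm (column 1 (A t)) *\<^sub>R axis 1 1" if "t \<in> I" for t
  proof -
    have "column 1 (B t) = norm (column 1 (A t)) *\<^sub>R (transpose R *v u)"
      unfolding B_def column_matrix_mult by (subst u(2)[OF that]) (rule matrix_vector_mult_scaleR)
    also have "transpose R *v u = axis 1 1"
      unfolding R(2)[symmetric] matrix_vector_mul_assoc orth by simp
    finally show ?thesis .
  qed
  have col4: "column 4 (B t) = l t *\<^sub>R column 1 (B t)" if "t \<in> I" for t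
    unfolding B_def column_matrix_mult l[OF that] by (rule matrix_vector_mult_scaleR)
  have zero: "B t $ 2 $ 1 = 0" "B t $ 3 $ 1 = 0" "B t $ 2 $ 4 = 0" "B t $ 3 $ 4 = 0" if "t \<in> I" for t
  proof -
    have "B t $ k $ 1 = 0" "B t $ k $ 4 = 0" if "k \<noteq> 1" for k
      using arg_cong[OF col1[OF \<open>t \<in> I\<close>], of "\<lambda>v. v $ k"] arg_cong[OF col4[OF \<open>t \<in> I\<close>], of "\<lambda>v. v $ k"] that
      by (simp_all add: column_def axis_def)
    then show "B t $ 2 $ 1 = 0" "B t $ 3 $ 1 = 0" "B t $ 2 $ 4 = 0" "B t $ 3 $ 4 = 0" by simp_all
  qed
  have det: "B t $ 1 $ 1 * (B t $ 2 $ 2 * B t $ 3 $ 3 - B t $ 2 $ 3 * B t $ 3 $ 2) = 1" if "t \<in> I" for t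
  proof -
    have "minor3 B 1 2 3 t = 1"
      using assms(5) that minor3_rotation[OF R(1), of B 1 2 3 t] by (simp add: time_conditions_def A)
    then show ?thesis
      by (simp add: minor3_eq_det det_3 column_def zero[OF that]) (simp add: algebra_simps)
  qed
  have "(B t $ 2 $ 2)\<^sup>2 + (B t $ 3 $ 2)\<^sup>2 \<noteq> 0" if "t \<in> I" for t
    using det[OF that] by (auto simp: sum_power2_eq_zero_iff)
  then obtain \<theta> p where \<theta>: "smooth_on I \<theta>" and p: "smooth_on I p"
    and polar: "\<And>t. t \<in> I \<Longrightarrow> B t $ 2 $ 2 = p t * cos (\<theta> t)" "\<And>t. t \<in> I \<Longrightarrow> B t $ 3 $ 2 = p t * sin (\<theta> t)"
    by (rule smooth_polar_coordinates[OF assms(1,2) sB[of 2 2] sB[of 3 2]]) blast+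
  define b23 where "b23 t = cos (\<theta> t) * B t $ 2 $ 3 + sin (\<theta> t) * B t $ 3 $ 3" for t
  define b33 where "b33 t = cos (\<theta> t) * B t $ 3 $ 3 - sin (\<theta> t) * B t $ 2 $ 3" for t
  have b23: "smooth_on I b23" unfolding b23_def by (intro smooth_on_arith assms(1) \<theta> sB)
  have cs: "cos (\<theta> t) * cos (\<theta> t) + sin (\<theta> t) * sin (\<theta> t) = 1" for t
    using sin_cos_squared_add[of "\<theta> t"] by (simp add: power2_eq_square)
  have one: "B t $ 1 $ 1 * p t * b33 t = 1" if "t \<in> I" for t
    using det[OF that] unfolding polar[OF that] b33_def by algebra
  then have nz: "B t $ 1 $ 1 \<noteq> 0" "p t \<noteq> 0" if "t \<in> I" for t using that by fastforce+
  have b33: "b33 t = 1 / (B t $ 1 $ 1 * p t)" if "t \<in> I" for t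
    using one[OF that] nz[OF that] by (simp add: field_simps)
  have nf: "A t = normal_form R \<theta> (\<lambda>t. B t $ 1 $ 1) (\<lambda>t. B t $ 1 $ 2) (\<lambda>t. B t $ 1 $ 3) (\<lambda>t. B t $ 1 $ 4) p b23 t"
    if "t \<in> I" for t
  proof -
    have "B t $ 2 $ 3 = cos (\<theta> t) * b23 t - sin (\<theta> t) * b33 t" "B t $ 3 $ 3 = sin (\<theta> t) * b23 t + cos (\<theta> t) * b33 t"
      using cs[of t] unfolding b23_def b33_def by algebra+
    then have "B t = rot_x (\<theta> t) ** triangular_factor (B t $ 1 $ 1) (B t $ 1 $ 2) (B t $ 1 $ 3) (B t $ 1 $ 4) (p t) (b23 t)"
      unfolding vec_eq_iff forall_3 forall_4
      by (simp add: rot_x_def triangular_factor_def matrix_matrix_mult_def sum_3 vector_4 zero[OF that]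
          polar[OF that] b33[OF that])
    then show ?thesis by (simp add: A normal_form_def matrix_mul_assoc[symmetric])
  qed
  have free: "free_data I \<theta> (\<lambda>t. B t $ 1 $ 1) p"
    using \<theta> p sB nz by (simp add: free_data_def)
  have "time_conditions I c A \<longleftrightarrow> time_conditions I c
      (normal_form R \<theta> (\<lambda>t. B t $ 1 $ 1) (\<lambda>t. B t $ 1 $ 2) (\<lambda>t. B t $ 1 $ 3) (\<lambda>t. B t $ 1 $ 4) p b23)"
    by (rule time_conditions_cong[OF assms(1)]) (rule nf)
  with assms(5) have "time_conditions I c
      (normal_form R \<theta> (\<lambda>t. B t $ 1 $ 1) (\<lambda>t. B t $ 1 $ 2) (\<lambda>t. B t $ 1 $ 3) (\<lambda>t. B t $ 1 $ 4) p b23)"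
    by simp
  then have "dependent_data I c \<theta> (\<lambda>t. B t $ 1 $ 1) (\<lambda>t. B t $ 1 $ 2) (\<lambda>t. B t $ 1 $ 3) (\<lambda>t. B t $ 1 $ 4) p b23"
    by (rule time_conditions_normal_form_iff_dependent_data[THEN iffD1, rotated -1])
      (intro assms(1) R(1) c14 free sB b23)+
  from that[OF c14 R(1) free this nf] show thesis .
qed

theorem theorem4p4:
  fixes I :: "real set"
  assumes "open I" and "is_interval I"
  shows
    "(\<forall>(A :: real \<Rightarrow> real^4^3) (c :: 4 \<Rightarrow> 4 \<Rightarrow> real).
        smooth_on I A \<and> columns_lin_indep I A \<and> time_conditions I c A \<longrightarrow>
        c 1 4 \<noteq> 0 \<and>
        (\<exists>R \<theta> b11 b12 b13 b14 b22 b23.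
          rotation_matrix R \<and> free_data I \<theta> b11 b22 \<and>
          dependent_data I c \<theta> b11 b12 b13 b14 b22 b23 \<and>
          (\<forall>t\<in>I. A t = normal_form R \<theta> b11 b12 b13 b14 b22 b23 t)))
     \<and>
     (\<forall>(c :: 4 \<Rightarrow> 4 \<Rightarrow> real) R \<theta> b11 b22.
        c 1 4 \<noteq> 0 \<and> rotation_matrix R \<and> free_data I \<theta> b11 b22 \<longrightarrow>
        (\<exists>b12 b13 b14 b23. dependent_data I c \<theta> b11 b12 b13 b14 b22 b23) \<and>
        (\<forall>b12 b13 b14 b23. dependent_data I c \<theta> b11 b12 b13 b14 b22 b23 \<longrightarrow>
          time_conditions I c (normal_form R \<theta> b11 b12 b13 b14 b22 b23)))"
proof (intro conjI allI impI; (elim conjE)?)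
  fix A :: "real \<Rightarrow> real^4^3" and c
  assume A: "smooth_on I A" "columns_lin_indep I A" "time_conditions I c A"
  show "c 1 4 \<noteq> 0"
    by (rule solution_has_normal_form[OF assms A])
  show "\<exists>R \<theta> b11 b12 b13 b14 b22 b23.
      rotation_matrix R \<and> free_data I \<theta> b11 b22 \<and>
      dependent_data I c \<theta> b11 b12 b13 b14 b22 b23 \<and>
      (\<forall>t\<in>I. A t = normal_form R \<theta> b11 b12 b13 b14 b22 b23 t)"
    by (rule solution_has_normal_form[OF assms A]) blast
next
  fix c :: "4 \<Rightarrow> 4 \<Rightarrow> real" and R :: "real^3^3" and \<theta> b11 b22
  assume free: "c 1 4 \<noteq> 0" "rotation_matrix R" "free_data I \<theta> b11 b22"
  show "\<exists>b12 b13 b14 b23. dependent_data I c \<theta> b11 b12 b13 b14 b22 b23"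
    by (intro dependent_data_exists assms free)
  fix b12 b13 b14 b23
  assume dep: "dependent_data I c \<theta> b11 b12 b13 b14 b22 b23"
  then have "smooth_on I b12" "smooth_on I b13" "smooth_on I b14" "smooth_on I b23"
    by (auto simp: dependent_data_def)
  with dep show "time_conditions I c (normal_form R \<theta> b11 b12 b13 b14 b22 b23)"
    using time_conditions_normal_form_iff_dependent_data[of I R c \<theta> b11 b22 b12 b13 b14 b23] assms(1) free by blast
qed

end
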